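(* For $f(x)=x+b+\frac{c}{x}$ with nonzero integers $b,c$, the Diophantine equation $z^2=f(x)^2+f(y)^2$ or the Diophantine equation $z^2=f(x)^2-f(y)^2$ has infinitely many nontrivial rational parametric solutions.
   Context: A rational parametric solution of one of the equations $z^2=f(x)^2\pm f(y)^2$ is a triple $(x,y,z)$ of rational functions in $\mathbb{Q}(T)$, where $T$ is an indeterminate (the parameter), not all constant, with $x\neq 0$ and $y\neq 0$ (so that $f(x),f(y)$ are defined), satisfying the equation identically in $\mathbb{Q}(T)$. A solution $(x,y,z)$ of $z^2=f(x)^2+f(y)^2$ is called nontrivial if $f(x)f(y)\neq 0$; a solution $(x,y,z)$ of $z^2=f(x)^2-f(y)^2$ is called nontrivial if $f(x)^2\neq f(y)^2$. *)

theory Defs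
  imports "HOL-Computational_Algebra.Computational_Algebra"
begin

type_synonym rat_fun = "rat poly fract"

definition const_fun :: "rat \<Rightarrow> rat_fun" where
  "const_fun q = to_fract [:q:]"

definition is_constant :: "rat_fun \<Rightarrow> bool" where
  "is_constant r \<longleftrightarrow> (\<exists>q. r = const_fun q)"

text \<open>The value at \<open>x = 0\<close> is an artefact of \<open>c / 0 = 0\<close>; every use below carries \<open>x \<noteq> 0\<close>.\<close>
definition laurent_f :: "int \<Rightarrow> int \<Rightarrow> rat_fun \<Rightarrow> rat_fun" where
  "laurent_f b c x = x + of_int b + of_int c / x"

definition parametric_triple :: "rat_fun \<times> rat_fun \<times> rat_fun \<Rightarrow> bool" where
  "parametric_triple = (\<lambda>(x, y, z).
     x \<noteq> 0 \<and> y \<noteq> 0 \<and> \<not> (is_constant x \<and> is_constant y \<and> is_constant z))"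

definition nontrivial_sum_solutions :: "int \<Rightarrow> int \<Rightarrow> (rat_fun \<times> rat_fun \<times> rat_fun) set" where
  "nontrivial_sum_solutions b c = {(x, y, z). parametric_triple (x, y, z) \<and>
     z ^ 2 = laurent_f b c x ^ 2 + laurent_f b c y ^ 2 \<and>
     laurent_f b c x * laurent_f b c y \<noteq> 0}"

definition nontrivial_diff_solutions :: "int \<Rightarrow> int \<Rightarrow> (rat_fun \<times> rat_fun \<times> rat_fun) set" where
  "nontrivial_diff_solutions b c = {(x, y, z). parametric_triple (x, y, z) \<and>
     z ^ 2 = laurent_f b c x ^ 2 - laurent_f b c y ^ 2 \<and>
     laurent_f b c x ^ 2 \<noteq> laurent_f b c y ^ 2}"

end

theory Submission
  imports Defs
begin

text \<open>On the line \<open>y = t x\<close> with \<open>1 - t\<^sup>2\<close> a square, the equation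
  \<open>z\<^sup>2 = f(x)\<^sup>2 - f(y)\<^sup>2\<close> becomes \<open>v\<^sup>2 = Q(x)\<close> with \<open>Q\<close> a quartic over \<open>\<rat>(t)\<close> whose
  leading coefficient is a square; completing the square leaves a linear equation for \<open>x\<close>.
  Taking \<open>t = 2u / (1 + u\<^sup>2)\<close> for \<open>u = T, T\<^sup>2, \<dots>\<close> gives infinitely many solutions, told apart
  by \<open>y / x = t\<close>. Everything required to be nonzero is checked by its value at \<open>T = 0\<close>, after
  clearing the poles that \<open>x\<close> and \<open>z\<close> have there.\<close>

text \<open>A relation rather than a function, so that an element with a pole at 0 simply has no
  value; any fraction with denominator nonvanishing at 0 may witness it, reduced or not.\<close>

definition has_value_at_0 :: "'a::field poly fract \<Rightarrow> 'a \<Rightarrow> bool" where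
  "has_value_at_0 r a \<longleftrightarrow> (\<exists>n d. r = Fract n d \<and> poly d 0 \<noteq> 0 \<and> a = poly n 0 / poly d 0)"

lemma has_value_at_0I:
  "poly d 0 \<noteq> 0 \<Longrightarrow> has_value_at_0 (Fract n d) (poly n 0 / poly d 0)"
  unfolding has_value_at_0_def by blast

lemma has_value_at_0_to_fract: "has_value_at_0 (to_fract n) (poly n 0)"
  using has_value_at_0I[of 1 n] by (simp add: to_fract_def)

lemma has_value_at_0_add:
  assumes "has_value_at_0 r a" "has_value_at_0 s b"
  shows "has_value_at_0 (r + s) (a + b)"
proof -
  obtain n d m e where "r = Fract n d" "poly d 0 \<noteq> 0" "a = poly n 0 / poly d 0"
    "s = Fract m e" "poly e 0 \<noteq> 0" "b = poly m 0 / poly e 0"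
    using assms unfolding has_value_at_0_def by auto
  moreover from this have "d \<noteq> 0" "e \<noteq> 0" by auto
  ultimately show ?thesis using has_value_at_0I[of "d * e" "n * e + m * d"]
    by (simp add: add_frac_eq)
qed

lemma has_value_at_0_mult:
  assumes "has_value_at_0 r a" "has_value_at_0 s b"
  shows "has_value_at_0 (r * s) (a * b)"
proof -
  obtain n d m e where "r = Fract n d" "poly d 0 \<noteq> 0" "a = poly n 0 / poly d 0"
    "s = Fract m e" "poly e 0 \<noteq> 0" "b = poly m 0 / poly e 0"
    using assms unfolding has_value_at_0_def by auto
  then show ?thesis using has_value_at_0I[of "d * e" "n * m"] by auto
qed

lemma has_value_at_0_inverse:
  assumes "has_value_at_0 r a" "a \<noteq> 0"
  shows "has_value_at_0 (inverse r) (inverse a)"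
proof -
  obtain n d where "r = Fract n d" "poly d 0 \<noteq> 0" "a = poly n 0 / poly d 0"
    using assms unfolding has_value_at_0_def by auto
  then show ?thesis using \<open>a \<noteq> 0\<close> has_value_at_0I[of n d] by auto
qed

text \<open>Uniqueness of the value, in the one case needed: every proof that an element is nonzero
  rests on it.\<close>

lemma has_value_at_0_0_iff: "has_value_at_0 0 a \<longleftrightarrow> a = 0"
proof
  assume "has_value_at_0 0 a"
  then obtain n d where "0 = Fract n d" "poly d 0 \<noteq> 0" "a = poly n 0 / poly d 0"
    unfolding has_value_at_0_def by auto
  moreover from this have "n = 0"
    by (metis eq_fract(1) mult_zero_left mult_eq_0_iff poly_0 Zero_fract_def zero_neq_one)
  ultimately show "a = 0" by simp
next
  assume "a = 0"
  then show "has_value_at_0 0 a" using has_value_at_0_to_fract[of 0] by simp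
qed

lemma has_value_at_0_of_int: "has_value_at_0 (of_int k) (of_int k)"
proof -
  have 1: "has_value_at_0 1 1" and m1: "has_value_at_0 (- 1) (- 1)" and 0: "has_value_at_0 0 0"
    using has_value_at_0_to_fract[of 1] has_value_at_0_to_fract[of "- 1"]
      has_value_at_0_to_fract[of 0] by (simp_all add: to_fract_uminus)
  show ?thesis
  proof (induction k rule: int_induct[of _ 0])
    case base then show ?case using 0 by simp
  next
    case (step1 i) then show ?case using has_value_at_0_add[OF step1(2) 1] by simp
  next
    case (step2 i) then show ?case using has_value_at_0_add[OF step2(2) m1] by simp
  qed
qed

lemma has_value_at_0_uminus:
  "has_value_at_0 r a \<Longrightarrow> has_value_at_0 (- r) (- a)"
  using has_value_at_0_mult[OF has_value_at_0_of_int[of "-1"]] by force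

lemma has_value_at_0_diff:
  "has_value_at_0 r a \<Longrightarrow> has_value_at_0 s b \<Longrightarrow> has_value_at_0 (r - s) (a - b)"
  using has_value_at_0_add[OF _ has_value_at_0_uminus] by force

lemma has_value_at_0_divide:
  "has_value_at_0 r a \<Longrightarrow> has_value_at_0 s b \<Longrightarrow> b \<noteq> 0 \<Longrightarrow> has_value_at_0 (r / s) (a / b)"
  using has_value_at_0_mult[OF _ has_value_at_0_inverse] by (force simp: divide_inverse)

lemma has_value_at_0_1: "has_value_at_0 1 1"
  using has_value_at_0_of_int[of 1] by simp

lemma has_value_at_0_numeral: "has_value_at_0 (numeral k) (numeral k)"
  using has_value_at_0_of_int[of "numeral k"] by simp

lemma has_value_at_0_power:
  "has_value_at_0 r a \<Longrightarrow> has_value_at_0 (r ^ n) (a ^ n)"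
  by (induction n) (auto intro: has_value_at_0_mult has_value_at_0_1)

lemmas has_value_at_0_intros =
  has_value_at_0_add has_value_at_0_mult has_value_at_0_of_int has_value_at_0_uminus
  has_value_at_0_diff has_value_at_0_divide has_value_at_0_1 has_value_at_0_numeral
  has_value_at_0_power

lemma nonzero_if_has_value_at_0: "has_value_at_0 r a \<Longrightarrow> a \<noteq> 0 \<Longrightarrow> r \<noteq> 0"
  by (auto simp: has_value_at_0_0_iff)

lemma is_constant_eq_0:
  assumes "is_constant r" "has_value_at_0 r 0"
  shows "r = 0"
proof -
  obtain q where q: "r = to_fract [:q:]"
    using assms(1) unfolding is_constant_def const_fun_def by auto
  \<comment> \<open>A constant \<open>q\<close> also has the value \<open>q\<close>, so 0 gets the
    value \<open>q - 0\<close>, which forces \<open>q = 0\<close>.\<close>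
  have "has_value_at_0 (r - r) (q - 0)"
    using has_value_at_0_to_fract[of "[:q:]"] assms(2) q by (intro has_value_at_0_diff) simp_all
  then show ?thesis using q by (simp add: has_value_at_0_0_iff)
qed

lemma is_constant_divide:
  assumes "is_constant r" "is_constant s"
  shows "is_constant (r / s)"
proof -
  obtain p q where pq: "r = to_fract [:p:]" "s = to_fract [:q:]"
    using assms unfolding is_constant_def const_fun_def by auto
  have "r / s = to_fract [:p / q:]"
  proof (cases "q = 0")
    case False
    then have "r = to_fract [:p / q:] * s"
      using pq by (simp flip: to_fract_mult)
    then show ?thesis using pq False by simp
  qed (simp add: pq)
  then show ?thesis unfolding is_constant_def const_fun_def by auto
qed

text \<open>With \<open>y = t x\<close>, the product \<open>(y z)\<^sup>2\<close> is a quartic in \<open>x\<close> with leading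
  coefficient \<open>(s t)\<^sup>2\<close>; the square of \<open>s t x\<^sup>2 + p t x + q t\<close> agrees with it in
  degrees 4, 3 and 2, so that equality becomes a linear equation for \<open>x\<close>.\<close>
lemma quartic_square_completion:
  fixes t s B C p q x y z :: "'a::field"
  assumes st: "s\<^sup>2 = 1 - t\<^sup>2" and sp: "s * p = B * (1 - t)" and sq: "p\<^sup>2 + 2 * s * q = 0"
    and lin: "(2 * p * q * t + 2 * B * C * (1 - t)) * y = - (q\<^sup>2 * t\<^sup>2 + C\<^sup>2 * s\<^sup>2)"
    and "t \<noteq> 0" "y \<noteq> 0" and y: "y = t * x" and z: "z = (s * t * x\<^sup>2 + p * t * x + q * t) / y"
  shows "z\<^sup>2 = (x + B + C / x)\<^sup>2 - (y + B + C / y)\<^sup>2"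
proof -
  have x: "x \<noteq> 0" using assms by auto
  \<comment> \<open>Compare coefficients in \<open>x\<close>: \<open>st\<close> and
    \<open>sp\<close> settle degrees 4 and 3, and \<open>sq\<close> degree 2, where the right side
    cancels. What remains vanishes by \<open>lin\<close>.\<close>
  have "(s * t * x\<^sup>2 + p * t * x + q * t)\<^sup>2
      = (1 - t) * (t * x\<^sup>2 - C) * ((1 + t) * t * x\<^sup>2 + 2 * B * t * x + (1 + t) * C)"
    using st sp sq lin unfolding y by algebra
  then have "(y * z)\<^sup>2 = (1 - t) * (t * x\<^sup>2 - C) * ((1 + t) * t * x\<^sup>2 + 2 * B * t * x + (1 + t) * C)"
    using z \<open>y \<noteq> 0\<close> by simp
  \<comment> \<open>The factors are \<open>(1 - t) * (t * x^2 - C)\<close> and the remaining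
    quadratic.\<close>
  also have "\<dots> = (y * (x + B + C / x) - y * (y + B + C / y)) * (y * (x + B + C / x) + y * (y + B + C / y))"
    unfolding y using x \<open>t \<noteq> 0\<close> by (simp add: field_simps power2_eq_square)
  also have "\<dots> = y\<^sup>2 * ((x + B + C / x)\<^sup>2 - (y + B + C / y)\<^sup>2)" by algebra
  finally show ?thesis using \<open>y \<noteq> 0\<close> by (simp add: power_mult_distrib)
qed

text \<open>Here \<open>u\<close> parametrizes the circle \<open>s^2 + t^2 = 1\<close>. As
  \<open>u\<close> vanishes at 0, the point \<open>(t, s)\<close> specializes to
  \<open>(0, 1)\<close>, where the denominator \<open>D\<close> takes the nonzero value
  \<open>2 * b * c\<close>.\<close>

lemma ex_nontrivial_diff_solution:
  fixes b c :: int
  assumes "b \<noteq> 0" "c \<noteq> 0" and u: "has_value_at_0 u 0" "u \<noteq> 0"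
  shows "\<exists>x y z. (x, y, z) \<in> nontrivial_diff_solutions b c \<and> y / x = 2 * u / (1 + u\<^sup>2)"
proof -
  define B C :: rat_fun where "B = of_int b" and "C = of_int c"
  define t where "t = 2 * u / (1 + u\<^sup>2)"
  define s where "s = (1 - u\<^sup>2) / (1 + u\<^sup>2)"
  \<comment> \<open>\<open>p\<close>, \<open>q\<close> and \<open>y\<close> solve \<open>sp\<close>,
    \<open>sq\<close> and \<open>lin\<close> of \<open>quartic_square_completion\<close> in turn.
    \<open>lin\<close> is solved for \<open>y\<close> because \<open>y\<close> is regular at 0,
    whereas \<open>x = y / t\<close> has a pole.\<close>
  define p where "p = B * (1 - t) / s"
  define q where "q = - (p\<^sup>2) / (2 * s)"
  define D where "D = 2 * p * q * t + 2 * B * C * (1 - t)"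
  define y where "y = - (q\<^sup>2 * t\<^sup>2 + C\<^sup>2 * s\<^sup>2) / D"
  define x where "x = y / t"
  define z where "z = (s * t * x\<^sup>2 + p * t * x + q * t) / y"
  let ?b = "of_int b :: rat" and ?c = "of_int c :: rat"
  have B: "has_value_at_0 B ?b" and C: "has_value_at_0 C ?c"
    unfolding B_def C_def by (rule has_value_at_0_of_int)+
  \<comment> \<open>Values are first stated unevaluated, mirroring the term, so that the
    introduction rules apply.\<close>
  have "has_value_at_0 (1 + u\<^sup>2) (1 + 0\<^sup>2)" by (intro has_value_at_0_intros u)
  then have u1: "1 + u\<^sup>2 \<noteq> 0" by (rule nonzero_if_has_value_at_0) simp
  have "has_value_at_0 t (2 * 0 / (1 + 0\<^sup>2))"
    unfolding t_def by (intro has_value_at_0_intros u) simp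
  then have t: "has_value_at_0 t 0" by simp
  have "has_value_at_0 s ((1 - 0\<^sup>2) / (1 + 0\<^sup>2))"
    unfolding s_def by (intro has_value_at_0_intros u) simp
  then have s: "has_value_at_0 s 1" by simp
  then have s0: "s \<noteq> 0" by (rule nonzero_if_has_value_at_0) simp
  have 2: "(2 :: rat_fun) \<noteq> 0"
    by (rule nonzero_if_has_value_at_0[OF has_value_at_0_numeral]) simp
  have t0: "t \<noteq> 0" using u u1 2 unfolding t_def by simp
  have "has_value_at_0 p (?b * (1 - 0) / 1)"
    unfolding p_def by (intro has_value_at_0_intros B t s) simp
  then have p: "has_value_at_0 p ?b" by simp
  have q: "has_value_at_0 q (- (?b\<^sup>2) / (2 * 1))"
    unfolding q_def by (intro has_value_at_0_intros p s) simp
  have "has_value_at_0 D (2 * ?b * (- (?b\<^sup>2) / (2 * 1)) * 0 + 2 * ?b * ?c * (1 - 0))"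
    unfolding D_def by (intro has_value_at_0_intros p q t B C)
  then have D: "has_value_at_0 D (2 * ?b * ?c)" by simp
  then have D0: "D \<noteq> 0" by (rule nonzero_if_has_value_at_0) (simp add: assms)
  have "has_value_at_0 y (- ((- (?b\<^sup>2) / (2 * 1))\<^sup>2 * 0\<^sup>2 + ?c\<^sup>2 * 1\<^sup>2) / (2 * ?b * ?c))"
    unfolding y_def by (intro has_value_at_0_intros p q t B C D s) (simp add: assms)
  then have y: "has_value_at_0 y (- ?c / (2 * ?b))"
    using assms by (simp add: power2_eq_square)
  then have y0: "y \<noteq> 0" by (rule nonzero_if_has_value_at_0) (simp add: assms)
  then have x0: "x \<noteq> 0" using t0 unfolding x_def by simp
  have yx: "y = t * x" using t0 unfolding x_def by simp
  have z2: "z\<^sup>2 = laurent_f b c x ^ 2 - laurent_f b c y ^ 2"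
    unfolding laurent_f_def
  proof (rule quartic_square_completion[where s = s and p = p and q = q and t = t])
    have "s * (1 + u\<^sup>2) = 1 - u\<^sup>2" "t * (1 + u\<^sup>2) = 2 * u"
      using u1 unfolding s_def t_def by simp_all
    then have "(s\<^sup>2 + t\<^sup>2 - 1) * (1 + u\<^sup>2)\<^sup>2 = 0" by algebra
    then have "s\<^sup>2 + t\<^sup>2 - 1 = 0" using u1 by simp
    then show "s\<^sup>2 = 1 - t\<^sup>2" by algebra
    show "(2 * p * q * t + 2 * of_int b * of_int c * (1 - t)) * y = - (q\<^sup>2 * t\<^sup>2 + (of_int c)\<^sup>2 * s\<^sup>2)"
      using D0 unfolding y_def D_def B_def C_def by simp
    show "p\<^sup>2 + 2 * s * q = 0" unfolding q_def using s0 2 by simp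
  qed (use s0 t0 y0 yx in \<open>simp_all add: z_def p_def B_def\<close>)
  \<comment> \<open>By \<open>z2\<close>, nontriviality means \<open>z \<noteq> 0\<close>.
    Multiplying by \<open>t * y\<close> clears the pole of \<open>z\<close>; the value at 0 is then
    \<open>c^2 / (4 * b^2)\<close>.\<close>
  have "t * (y * z) = s * y\<^sup>2 + p * t * y + q * t\<^sup>2"
    using y0 t0 unfolding z_def x_def by (simp add: field_simps power2_eq_square)
  moreover have "has_value_at_0 (s * y\<^sup>2 + p * t * y + q * t\<^sup>2)
      (1 * (- ?c / (2 * ?b))\<^sup>2 + ?b * 0 * (- ?c / (2 * ?b)) + (- (?b\<^sup>2) / (2 * 1)) * 0\<^sup>2)"
    by (intro has_value_at_0_intros s y p t q)
  then have "s * y\<^sup>2 + p * t * y + q * t\<^sup>2 \<noteq> 0"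
    by (rule nonzero_if_has_value_at_0) (simp add: assms)
  ultimately have "z \<noteq> 0" by auto
  \<comment> \<open>Otherwise \<open>t = y / x\<close> would be a constant with value 0, hence
    0.\<close>
  have "\<not> (is_constant x \<and> is_constant y)"
    using is_constant_divide[of y x] is_constant_eq_0[OF _ t] t0 x0 yx by auto
  then have "(x, y, z) \<in> nontrivial_diff_solutions b c"
    using z2 \<open>z \<noteq> 0\<close> x0 y0
    unfolding nontrivial_diff_solutions_def parametric_triple_def by auto
  moreover have "y / x = t" using yx x0 by simp
  ultimately show ?thesis unfolding t_def by blast
qed

theorem theorem1p1:
  fixes b c :: int
  assumes "b \<noteq> 0" and "c \<noteq> 0"
  shows "infinite (nontrivial_sum_solutions b c) \<or> infinite (nontrivial_diff_solutions b c)"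
proof -
  define U where "U = {u :: rat_fun. has_value_at_0 u 0 \<and> u \<noteq> 0}"
  define g where "g = (\<lambda>u :: rat_fun. 2 * u / (1 + u\<^sup>2))"
  \<comment> \<open>\<open>Suc n\<close> excludes the monomial 1, which does not vanish at
    0.\<close>
  have "infinite (range (\<lambda>n. to_fract (monom (1 :: rat) (Suc n))))"
    by (rule range_inj_infinite) (auto intro!: injI simp: monom_eq_iff')
  moreover have "range (\<lambda>n. to_fract (monom 1 (Suc n))) \<subseteq> U"
    unfolding U_def using has_value_at_0_to_fract[of "monom 1 (Suc _)"]
    by (auto simp: poly_monom)
  ultimately have "infinite U" using finite_subset by blast
  moreover have "inj_on g U"
  \<comment> \<open>\<open>g u = g w\<close> only for \<open>w = u\<close> or
    \<open>u * w = 1\<close>; the latter fails since \<open>u * w\<close> has value 0.\<close>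
  proof (rule inj_onI)
    fix u w assume uw: "u \<in> U" "w \<in> U" and eq: "g u = g w"
    have 2: "(2 :: rat_fun) \<noteq> 0"
      by (rule nonzero_if_has_value_at_0[OF has_value_at_0_numeral]) simp
    have "has_value_at_0 (1 - u * w) (1 - 0 * 0)" "has_value_at_0 (1 + u\<^sup>2) (1 + 0\<^sup>2)"
      "has_value_at_0 (1 + w\<^sup>2) (1 + 0\<^sup>2)"
      by (intro has_value_at_0_intros; use uw in \<open>simp add: U_def\<close>)+
    then have nz: "1 - u * w \<noteq> 0" "1 + u\<^sup>2 \<noteq> 0" "1 + w\<^sup>2 \<noteq> 0"
      by (auto dest: nonzero_if_has_value_at_0)
    have "2 * u * (1 + w\<^sup>2) = 2 * w * (1 + u\<^sup>2)"
      using eq nz unfolding g_def by (simp add: frac_eq_eq)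
    then have "2 * ((u - w) * (1 - u * w)) = 0" by algebra
    then show "u = w" using 2 nz by simp
  qed
  ultimately have "infinite (g ` U)" by (simp add: finite_image_iff)
  \<comment> \<open>Infinitely many ratios \<open>y / x\<close> occur, so the second disjunct
    holds.\<close>
  moreover have "g ` U \<subseteq> (\<lambda>(x, y, z). y / x) ` nontrivial_diff_solutions b c"
    using ex_nontrivial_diff_solution[OF assms] unfolding U_def g_def by force
  ultimately show ?thesis by (meson finite_imageI finite_subset)
qed

end
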